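(* Let $X$ be a real Banach space, $Y$ a real Hilbert space, $u_b$ a fixed element of a vector space containing $X$, and $A:X+\operatorname{span}\{u_b\}\to Y$ a linear map whose restriction to $X$ is bounded from $X$ to $Y$. Let $f\in Y$. Let $\mathbb R^N\ni\theta\mapsto u_\theta=u_b+\widetilde u_\theta\in u_b+X$ be a parameterized family such that $\theta\mapsto \widetilde u_\theta\in X$ is of class $C^1$, let $\mathcal V_\theta:=\operatorname{span}\{\partial_{\theta_k}u_\theta: k=1,\dots,N\}\subset X$, and assume the compatibility condition $\widetilde u_\theta\in\mathcal V_\theta$ for every $\theta\in\mathbb R^N$. Let $J(\theta):=\frac12\|Au_\theta-f\|_Y^2$ and let $\theta^*$ be a critical point of $J$, i.e. $\nabla_\theta J(\theta^* )=0$. Then $$A(u_{\theta^*}-u_b)=P_{A\mathcal V_{\theta^*}}(f-Au_b)$$ and $$\|Au_{\theta^*}-f\|_Y=\operatorname{dist}_Y\bigl(f-Au_b,\,A\mathcal V_{\theta^*}\bigr),$$ where $P_{A\mathcal V_{\theta^*}}$ denotes the orthogonal projection of $Y$ onto the (finite-dimensional, hence closed) subspace $A\mathcal V_{\theta^*}$.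
   Context: The setting models a linear equation $Au=f$ with prescribed boundary data: $X$ carries the homogeneous form of the boundary conditions, $u_b$ is a fixed function satisfying the prescribed data (with $u_b=0$ for homogeneous data), and trial functions lie in the affine space $u_b+X$. $\operatorname{dist}_Y(y,W):=\inf_{w\in W}\|y-w\|_Y$. *)

theory Defs
  imports "HOL-Analysis.Analysis"
begin

text \<open>Linearity of a map whose domain is a linear subspace \<open>D\<close>; values outside \<open>D\<close> are irrelevant.\<close>

definition linear_map_on :: "'a::real_vector set \<Rightarrow> ('a \<Rightarrow> 'b::real_vector) \<Rightarrow> bool" where
  "linear_map_on D A \<longleftrightarrow>
     (\<forall>x\<in>D. \<forall>y\<in>D. A (x + y) = A x + A y) \<and> (\<forall>c. \<forall>x\<in>D. A (c *\<^sub>R x) = c *\<^sub>R A x)"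

definition C1_map :: "('a::real_normed_vector \<Rightarrow> 'b::real_normed_vector) \<Rightarrow> bool" where
  "C1_map g \<longleftrightarrow>
     (\<exists>g' :: 'a \<Rightarrow> 'a \<Rightarrow>\<^sub>L 'b.
        (\<forall>x. (g has_derivative blinfun_apply (g' x)) (at x)) \<and> continuous_on UNIV g')"

definition partial_deriv :: "'n::finite \<Rightarrow> (real ^ 'n \<Rightarrow> 'x::real_normed_vector) \<Rightarrow> real ^ 'n \<Rightarrow> 'x" where
  "partial_deriv k g \<theta> = vector_derivative (\<lambda>t. g (\<theta> + t *\<^sub>R axis k 1)) (at 0)"

text \<open>The family \<open>u\<^sub>\<theta> = u\<^sub>b + g \<theta>\<close> lives in an affine space over the Banach space \<open>X\<close>. Its
  difference quotients are those of its \<open>X\<close>-component \<open>g\<close>, and its partial derivatives are the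
  limits of these in the norm of \<open>X\<close>, so the tangent space is expressed through \<open>g\<close>.\<close>

definition tangent_span :: "(real ^ 'n \<Rightarrow> 'x::real_normed_vector) \<Rightarrow> real ^ 'n \<Rightarrow> 'x set" where
  "tangent_span g \<theta> = span {partial_deriv k g \<theta> | k. k \<in> UNIV}"

definition residual_loss :: "('e \<Rightarrow> 'y::real_normed_vector) \<Rightarrow> 'y \<Rightarrow> ('p \<Rightarrow> 'e) \<Rightarrow> 'p \<Rightarrow> real" where
  "residual_loss A f u \<theta> = (1 / 2) * (norm (A (u \<theta>) - f))\<^sup>2"

text \<open>Orthogonal projection onto a subspace \<open>W\<close>. It is uniquely determined where it exists (see
  below), and exists whenever \<open>W\<close> is complete, in particular finite-dimensional.\<close>

definition orth_proj :: "'y::real_inner set \<Rightarrow> 'y \<Rightarrow> 'y" where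
  "orth_proj W y = (THE p. p \<in> W \<and> (\<forall>w\<in>W. orthogonal (y - p) w))"

lemma orth_proj_eqI:
  assumes W: "subspace W" and p: "p \<in> W" "\<And>w. w \<in> W \<Longrightarrow> orthogonal (y - p) w"
  shows "orth_proj W y = p"
  unfolding orth_proj_def
proof (rule the_equality)
  show "p \<in> W \<and> (\<forall>w\<in>W. orthogonal (y - p) w)"
    using p by blast
next
  fix q assume q: "q \<in> W \<and> (\<forall>w\<in>W. orthogonal (y - q) w)"
  have "q - p \<in> W"
    using W p(1) q by (simp add: subspace_diff)
  then have "inner (y - p) (q - p) = 0" "inner (y - q) (q - p) = 0"
    using p(2) q by (auto simp: orthogonal_def)
  then have "inner (q - p) (q - p) = 0"
    by (simp add: inner_diff_left)
  then show "q = p"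
    by simp
qed

end

theory Submission
  imports Defs
begin

text \<open>With \<open>L = A \<circ> \<iota>\<close> and \<open>r = A u\<^sub>\<theta> - f\<close> at the critical point, the chain rule gives
  \<open>r \<bullet> L (\<partial>\<^sub>k u') = 0\<close> for every \<open>k\<close>, so \<open>r\<close> is orthogonal to the image of the tangent
  space. By compatibility, \<open>L u'\<close> itself lies in that image; hence it is the orthogonal
  projection of \<open>f - A u\<^sub>b\<close>, and the residual realises the distance.\<close>

text \<open>By Pythagoras: \<open>y - w\<close> splits into \<open>y - p\<close> and
  \<open>p - w\<close>, orthogonal because \<open>p - w\<close> lies in \<open>W\<close>, so no
  \<open>w\<close> is closer to \<open>y\<close> than \<open>p\<close>.\<close>

lemma infdist_eq_norm_diff_orthogonal:
  fixes y :: "'a::real_inner"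
  assumes W: "subspace W" and p: "p \<in> W" "\<And>w. w \<in> W \<Longrightarrow> orthogonal (y - p) w"
  shows "infdist y W = norm (y - p)"
proof (rule antisym)
  show "infdist y W \<le> norm (y - p)"
    using infdist_le[OF p(1), of y] by (simp add: dist_norm)
  have "norm (y - p) \<le> dist y w" if "w \<in> W" for w
  proof -
    have "orthogonal (y - p) (p - w)"
      using that by (intro p(2) subspace_diff[OF W p(1)])
    then have "(norm (y - w))\<^sup>2 = (norm (y - p))\<^sup>2 + (norm (p - w))\<^sup>2"
      using norm_add_Pythagorean[of "y - p" "p - w"] by simp
    then have "(norm (y - p))\<^sup>2 \<le> (norm (y - w))\<^sup>2"
      by simp
    then show ?thesis
      by (simp add: dist_norm)
  qed
  moreover have "W \<noteq> {}"
    using p(1) by blast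
  ultimately show "norm (y - p) \<le> infdist y W"
    by (simp add: infdist_notempty cINF_greatest)
qed

text \<open>Chain rule along the coordinate line through \<theta>; this ties the generators of the
  tangent space to the total derivative.\<close>

lemma partial_deriv_eq_derivative:
  assumes "(g has_derivative g') (at \<theta>)"
  shows "partial_deriv k g \<theta> = g' (axis k 1)"
proof -
  have "((\<lambda>t. \<theta> + t *\<^sub>R axis k 1) has_derivative (\<lambda>t. t *\<^sub>R axis k 1)) (at 0)"
    by (auto intro!: derivative_eq_intros)
  \<comment> \<open>The base point is written as the value of the line at \<open>t = 0\<close>, the
    form in which the chain rule expects it.\<close>
  moreover have "(g has_derivative g') (at (\<theta> + 0 *\<^sub>R axis k 1))"
    using assms by simp
  ultimately have "((\<lambda>t. g (\<theta> + t *\<^sub>R axis k 1)) has_derivative (\<lambda>t. g' (t *\<^sub>R axis k 1))) (at 0)"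
    by (rule has_derivative_compose)
  moreover have "linear g'"
    using assms by (rule has_derivative_linear)
  ultimately have "((\<lambda>t. g (\<theta> + t *\<^sub>R axis k 1)) has_vector_derivative g' (axis k 1)) (at 0)"
    by (simp add: has_vector_derivative_def linear_scale)
  then show ?thesis
    unfolding partial_deriv_def by (rule vector_derivative_at)
qed

text \<open>The derivative of the half square is
  \<open>h \<mapsto> R \<theta> \<bullet> R' h\<close>; uniqueness of derivatives identifies it with
  zero.\<close>

lemma critical_half_norm_square:
  fixes R :: "'p::real_inner \<Rightarrow> 'y::real_inner"
  assumes "(R has_derivative R') (at \<theta>)"
    and "GDERIV (\<lambda>\<theta>. (1 / 2) * (norm (R \<theta>))\<^sup>2) \<theta> :> 0"
  shows "R \<theta> \<bullet> R' h = 0"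
proof -
  have "((\<lambda>\<theta>. (1 / 2) * (R \<theta> \<bullet> R \<theta>)) has_derivative (\<lambda>h. R \<theta> \<bullet> R' h)) (at \<theta>)"
    using assms(1) by (auto intro!: derivative_eq_intros simp: inner_commute)
  moreover have "((\<lambda>\<theta>. (1 / 2) * (R \<theta> \<bullet> R \<theta>)) has_derivative (\<lambda>h. 0)) (at \<theta>)"
    using assms(2) by (simp add: gderiv_def power2_norm_eq_inner)
  ultimately show ?thesis
    using has_derivative_unique by metis
qed

lemma orthogonal_span_image:
  assumes "linear L" and "\<And>s. s \<in> S \<Longrightarrow> orthogonal y (L s)"
    and "w \<in> L ` span S"
  shows "orthogonal y w"
proof -
  have "w \<in> span (L ` S)"
    using assms(1,3) by (simp add: linear_span_image)
  then show ?thesis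
    by (rule orthogonal_to_span) (use assms(2) in auto)
qed

theorem theorem1:
  fixes \<iota> :: "'x::banach \<Rightarrow> 'e::real_vector"
    and u\<^sub>b :: 'e
    and A :: "'e \<Rightarrow> 'y::{real_inner, complete_space}"
    and f :: 'y
    and u :: "real ^ 'n \<Rightarrow> 'e"
    and u' :: "real ^ 'n \<Rightarrow> 'x"
    and \<theta>\<^sub>s :: "real ^ 'n"
  assumes "linear \<iota>" and "inj \<iota>"
    and "linear_map_on (range \<iota> + span {u\<^sub>b}) A"
    and "bounded_linear (\<lambda>x. A (\<iota> x))"
    and "\<And>\<theta>. u \<theta> = u\<^sub>b + \<iota> (u' \<theta>)"
    and "C1_map u'"
    and "\<And>\<theta>. u' \<theta> \<in> tangent_span u' \<theta>"
    and "GDERIV (residual_loss A f u) \<theta>\<^sub>s :> 0"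
  shows "A (u \<theta>\<^sub>s - u\<^sub>b) = orth_proj (A ` \<iota> ` tangent_span u' \<theta>\<^sub>s) (f - A u\<^sub>b)
    \<and> norm (A (u \<theta>\<^sub>s) - f) = infdist (f - A u\<^sub>b) (A ` \<iota> ` tangent_span u' \<theta>\<^sub>s)"
proof -
  define L where "L x = A (\<iota> x)" for x
  define R where "R \<theta> = A u\<^sub>b + L (u' \<theta>) - f" for \<theta>
  let ?W = "A ` \<iota> ` tangent_span u' \<theta>\<^sub>s"
  have L: "bounded_linear L"
    using assms(4) by (simp add: L_def[abs_def])
  have W: "?W = L ` tangent_span u' \<theta>\<^sub>s"
    by (simp add: L_def image_image)
  \<comment> \<open>\<open>A\<close> is additive only on this sum of subspaces, so
    \<open>\<iota> x\<close> and \<open>u\<^sub>b\<close> are first placed in it, each by adding a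
    zero from the other summand.\<close>
  have "\<iota> x \<in> range \<iota> + span {u\<^sub>b}" for x
    using set_plus_intro[of "\<iota> x" "range \<iota>" 0 "span {u\<^sub>b}"] by (simp add: span_zero)
  moreover have "u\<^sub>b \<in> range \<iota> + span {u\<^sub>b}"
    using set_plus_intro[OF rangeI[of \<iota> 0], of u\<^sub>b "span {u\<^sub>b}"] assms(1)
    by (simp add: linear_0 span_base)
  ultimately have "A (u \<theta>) = A u\<^sub>b + L (u' \<theta>)" for \<theta>
    using assms(3) by (simp add: assms(5) linear_map_on_def L_def)
  then have R: "A (u \<theta>) - f = R \<theta>" for \<theta>
    by (simp add: R_def)
  obtain D where D: "(u' has_derivative D) (at \<theta>\<^sub>s)"
    using assms(6) by (auto simp: C1_map_def)
  have "(R has_derivative (\<lambda>h. L (D h))) (at \<theta>\<^sub>s)"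
    unfolding R_def[abs_def]
    by (auto intro!: derivative_eq_intros bounded_linear.has_derivative[OF L] D)
  moreover have "GDERIV (\<lambda>\<theta>. (1 / 2) * (norm (R \<theta>))\<^sup>2) \<theta>\<^sub>s :> 0"
    using assms(8) by (simp add: residual_loss_def[abs_def] R)
  ultimately have critical: "R \<theta>\<^sub>s \<bullet> L (D h) = 0" for h
    by (rule critical_half_norm_square)
  have residual: "f - A u\<^sub>b - L (u' \<theta>\<^sub>s) = - R \<theta>\<^sub>s"
    by (simp add: R_def)
  have orth: "orthogonal (f - A u\<^sub>b - L (u' \<theta>\<^sub>s)) w" if "w \<in> ?W" for w
  proof (rule orthogonal_span_image[OF bounded_linear.linear[OF L]])
    show "w \<in> L ` span {partial_deriv k u' \<theta>\<^sub>s | k. k \<in> UNIV}"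
      using that unfolding W unfolding tangent_span_def .
    \<comment> \<open>Each generator is \<open>D (axis k 1)\<close>, so this is
      \<open>critical\<close> in a coordinate direction, up to the sign in
      \<open>residual\<close>.\<close>
    show "orthogonal (f - A u\<^sub>b - L (u' \<theta>\<^sub>s)) (L s)"
      if "s \<in> {partial_deriv k u' \<theta>\<^sub>s | k. k \<in> UNIV}" for s
      using that critical
      by (auto simp: residual orthogonal_def partial_deriv_eq_derivative[OF D])
  qed
  have sub: "subspace ?W"
    unfolding W unfolding tangent_span_def
    by (intro linear_subspace_image bounded_linear.linear[OF L] subspace_span)
  \<comment> \<open>Compatibility enters here: it makes \<open>L (u' \<theta>\<^sub>s)\<close> a
    candidate for the projection, not merely a point with orthogonal error.\<close>
  have mem: "L (u' \<theta>\<^sub>s) \<in> ?W"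
    unfolding W using assms(7) by blast
  have "A (u \<theta>\<^sub>s - u\<^sub>b) = L (u' \<theta>\<^sub>s)"
    by (simp add: assms(5) L_def)
  then show ?thesis
    using orth_proj_eqI[OF sub mem orth] infdist_eq_norm_diff_orthogonal[OF sub mem orth]
    by (simp add: residual R)
qed

end
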